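(* $[\mathbf{Txt}\mathbf{Td}\mathbf{Ex}_W]_{\mathbf{REC}} \setminus [\mathbf{Txt}\mathbf{G}\mathbf{Ex}_C]_{\mathbf{REC}} \neq \emptyset$. That is, there is a class of recursive languages learnable by a (partial computable) transductive learner converging to $W$-indices that is not learnable by any (partial computable) full-information learner converging to $C$-indices.
   Context: Fix an acceptable numbering $(\varphi_e)_{e\in\mathbb{N}}$ of all partial computable functions. $W_e=\mathrm{dom}(\varphi_e)$. A number $e$ is a $C$-index if $\varphi_e$ is total with values in $\{0,1\}$; then $C_e=\{x:\varphi_e(x)=1\}$. $\mathbf{REC}$ is the collection of recursive (decidable) subsets of $\mathbb{N}$; $\mathcal{P}$ and $\mathcal{R}$ are the partial computable and total computable functions. Fix a pause symbol $\#$. A text is a total function $T:\mathbb{N}\to\mathbb{N}\cup\{\#\}$, $\mathrm{content}(T)=\mathrm{range}(T)\setminus\{\#\}$, $T$ is a text for $L$ if $\mathrm{content}(T)=L$, and $T[n]=(T(0),\dots,T(n-1))$. A learner is some $h\in\mathcal{P}$ (finite sequences/sets coded as numbers). Interaction operators give the hypothesis sequence $\beta(h,T)$: full-information $\mathbf{G}(h,T)(i)=h(T[i])$; transductive: $\mathbf{Td}(h,T)(0)=?$, and for $i>0$, $\mathbf{Td}(h,T)(i)=\mathbf{Td}(h,T)(i-1)$ if $h(T(i-1))=?$, else $h(T(i-1))$ (here "?" is a special output meaning "no new hypothesis"). Success criteria on a hypothesis sequence $p$ and text $T$: $\mathbf{Ex}_C$: there is $n_0$ such that $p(n)=p(n_0)$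 for all $n\ge n_0$ and $p(n_0)$ is a $C$-index with $C_{p(n_0)}=\mathrm{content}(T)$; $\mathbf{Ex}_W$: same but with $W_{p(n_0)}=\mathrm{content}(T)$. A learner $h$ $\mathbf{Txt}\beta\delta$-learns $L$ if $\delta(\beta(h,T),T)$ holds for every text $T$ for $L$. $[\mathbf{Txt}\beta\delta]_{\mathbf{REC}}$ denotes the set of all classes $\mathcal{L}\subseteq\mathbf{REC}$ such that a single learner $h\in\mathcal{P}$ $\mathbf{Txt}\beta\delta$-learns every $L\in\mathcal{L}$. *)

theory Defs
  imports Main "HOL-Library.Nat_Bijection"
begin

section \<open>Partial computable functions\<close>

text \<open>
  \<open>partrec k f\<close>: on argument lists of length \<open>k\<close>, \<open>f\<close> is a \<open>k\<close>-ary partial recursive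
  function in the sense of Kleene, with \<open>None\<close> for "undefined". The behaviour of \<open>f\<close> on lists
  of any other length is irrelevant. In the minimisation rule, all values below the zero that is
  found have to be defined.
\<close>

inductive partrec :: "nat \<Rightarrow> (nat list \<Rightarrow> nat option) \<Rightarrow> bool" where
  zero: "partrec k (\<lambda>xs. Some 0)"
| succ: "partrec 1 (\<lambda>xs. Some (Suc (hd xs)))"
| proj: "i < k \<Longrightarrow> partrec k (\<lambda>xs. Some (xs ! i))"
| comp: "partrec (length gs) f \<Longrightarrow> (\<forall>g \<in> set gs. partrec k g) \<Longrightarrow>
    partrec k (\<lambda>xs. Option.bind (those (map (\<lambda>g. g xs) gs)) f)"
| prim: "partrec k f \<Longrightarrow> partrec (Suc (Suc k)) g \<Longrightarrow>
    partrec (Suc k) (\<lambda>xs. rec_nat (f (tl xs))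
      (\<lambda>n r. Option.bind r (\<lambda>y. g (n # y # tl xs))) (hd xs))"
| mini: "partrec (Suc k) f \<Longrightarrow>
    partrec k (\<lambda>xs.
      if \<exists>z. f (z # xs) = Some 0 \<and> (\<forall>y<z. f (y # xs) \<noteq> None)
      then Some (LEAST z. f (z # xs) = Some 0) else None)"

definition partial_computable :: "(nat \<Rightarrow> nat option) \<Rightarrow> bool" where
  "partial_computable f \<longleftrightarrow> (\<exists>r. partrec 1 r \<and> (\<forall>x. r [x] = f x))"

definition partial_computable2 :: "(nat \<Rightarrow> nat \<Rightarrow> nat option) \<Rightarrow> bool" where
  "partial_computable2 f \<longleftrightarrow> (\<exists>r. partrec 2 r \<and> (\<forall>x y. r [x, y] = f x y))"

definition total_computable :: "(nat \<Rightarrow> nat) \<Rightarrow> bool" where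
  "total_computable f \<longleftrightarrow> partial_computable (\<lambda>x. Some (f x))"

definition REC :: "nat set set" where
  "REC = {A. total_computable (\<lambda>x. if x \<in> A then 1 else 0)}"

text \<open>
  Acceptable (Goedel) numberings in the sense of Rogers: an enumeration of all unary partial
  computable functions with a computable universal function, into which every other computable
  numbering can be translated computably.
\<close>

definition acceptable_numbering :: "(nat \<Rightarrow> nat \<Rightarrow> nat option) \<Rightarrow> bool" where
  "acceptable_numbering \<phi> \<longleftrightarrow>
     range \<phi> = {f. partial_computable f} \<and>
     partial_computable2 \<phi> \<and>
     (\<forall>\<psi>. partial_computable2 \<psi> \<longrightarrow> (\<exists>t. total_computable t \<and> (\<forall>e. \<phi> (t e) = \<psi> e)))"

definition W_set :: "(nat \<Rightarrow> nat \<Rightarrow> nat option) \<Rightarrow> nat \<Rightarrow> nat set" where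
  "W_set \<phi> e = dom (\<phi> e)"

definition C_index :: "(nat \<Rightarrow> nat \<Rightarrow> nat option) \<Rightarrow> nat \<Rightarrow> bool" where
  "C_index \<phi> e \<longleftrightarrow> (\<forall>x. \<phi> e x = Some 0 \<or> \<phi> e x = Some 1)"

definition C_set :: "(nat \<Rightarrow> nat \<Rightarrow> nat option) \<Rightarrow> nat \<Rightarrow> nat set" where
  "C_set \<phi> e = {x. \<phi> e x = Some 1}"

section \<open>Texts and learners\<close>

text \<open>In a text, \<open>None\<close> is the pause symbol.\<close>

type_synonym lang_text = "nat \<Rightarrow> nat option"

definition content :: "lang_text \<Rightarrow> nat set" where
  "content T = {x. Some x \<in> range T}"

definition is_text_for :: "lang_text \<Rightarrow> nat set \<Rightarrow> bool" where
  "is_text_for T L \<longleftrightarrow> content T = L"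

fun code_datum :: "nat option \<Rightarrow> nat" where
  "code_datum None = 0"
| "code_datum (Some x) = Suc x"

definition code_seq :: "nat option list \<Rightarrow> nat" where
  "code_seq ds = list_encode (map code_datum ds)"

definition initial_segment :: "lang_text \<Rightarrow> nat \<Rightarrow> nat option list" where
  "initial_segment T n = map T [0..<n]"

text \<open>
  The output alphabet of a learner is the natural numbers together with the symbol "?", here
  called \<open>Query\<close>; outputs are coded as numbers by reserving \<open>0\<close> for "?".
\<close>

datatype hyp = Query | Index nat

fun decode_hyp :: "nat \<Rightarrow> hyp" where
  "decode_hyp 0 = Query"
| "decode_hyp (Suc e) = Index e"

type_synonym learner = "nat \<Rightarrow> nat option"

text \<open>Hypothesis sequences are partial: \<open>None\<close> means that the learner diverges.\<close>

type_synonym hyp_seq = "nat \<Rightarrow> hyp option"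

definition hyp_output :: "learner \<Rightarrow> nat \<Rightarrow> hyp option" where
  "hyp_output h c = map_option decode_hyp (h c)"

definition G :: "learner \<Rightarrow> lang_text \<Rightarrow> hyp_seq" where
  "G h T i = hyp_output h (code_seq (initial_segment T i))"

primrec Td :: "learner \<Rightarrow> lang_text \<Rightarrow> hyp_seq" where
  "Td h T 0 = Some Query"
| "Td h T (Suc i) =
     (if hyp_output h (code_datum (T i)) = Some Query then Td h T i
      else hyp_output h (code_datum (T i)))"

definition Ex_C :: "(nat \<Rightarrow> nat \<Rightarrow> nat option) \<Rightarrow> hyp_seq \<Rightarrow> lang_text \<Rightarrow> bool" where
  "Ex_C \<phi> p T \<longleftrightarrow> (\<exists>n\<^sub>0. (\<forall>n\<ge>n\<^sub>0. p n = p n\<^sub>0) \<and>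
     (\<exists>e. p n\<^sub>0 = Some (Index e) \<and> C_index \<phi> e \<and> C_set \<phi> e = content T))"

definition Ex_W :: "(nat \<Rightarrow> nat \<Rightarrow> nat option) \<Rightarrow> hyp_seq \<Rightarrow> lang_text \<Rightarrow> bool" where
  "Ex_W \<phi> p T \<longleftrightarrow> (\<exists>n\<^sub>0. (\<forall>n\<ge>n\<^sub>0. p n = p n\<^sub>0) \<and>
     (\<exists>e. p n\<^sub>0 = Some (Index e) \<and> W_set \<phi> e = content T))"

definition Txt_learns ::
  "(learner \<Rightarrow> lang_text \<Rightarrow> hyp_seq) \<Rightarrow> (hyp_seq \<Rightarrow> lang_text \<Rightarrow> bool) \<Rightarrow> learner \<Rightarrow> nat set \<Rightarrow> bool" where
  "Txt_learns \<beta> \<delta> h L \<longleftrightarrow> (\<forall>T. is_text_for T L \<longrightarrow> \<delta> (\<beta> h T) T)"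

definition Txt_REC ::
  "(learner \<Rightarrow> lang_text \<Rightarrow> hyp_seq) \<Rightarrow> (hyp_seq \<Rightarrow> lang_text \<Rightarrow> bool) \<Rightarrow> nat set set set" where
  "Txt_REC \<beta> \<delta> = {\<L>. \<L> \<subseteq> REC \<and>
     (\<exists>h. partial_computable h \<and> (\<forall>L\<in>\<L>. Txt_learns \<beta> \<delta> h L))}"

end

theory Submission imports Defs Complex_Main
begin

text \<open>
  For every \<open>e\<close> a language \<open>L e\<close> of pairs \<open>(e, k)\<close> is enumerated so as to defeat \<open>\<phi> e\<close> as a
  learner. Having presented \<open>(e, 0), \<dots>, (e, k)\<close> in a segment \<open>\<sigma>\<close>, search by dovetailing for an
  \<open>n\<close> such that the conjecture of \<open>\<phi> e\<close> on \<open>\<sigma> #\<^sup>n\<close> decides \<open>(e, Suc k)\<close> negatively; if one is found,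
  continue with \<open>\<sigma> #\<^sup>n (e, Suc k)\<close>. If all searches succeed, then \<open>\<phi> e\<close> makes infinitely many
  wrong conjectures on the resulting text. If one fails, then on \<open>\<sigma> # # \<dots>\<close> it never
  conjectures that \<open>(e, Suc k)\<close> is absent, although it is. In both cases \<open>L e\<close> is recursive, as it
  consists of all pairs \<open>(e, k)\<close> or of finitely many. The first component of any datum yields a
  \<open>W\<close>-index of \<open>L e\<close>, so a transductive learner never needs to change its mind.
\<close>

section \<open>Closure properties of the partial recursive functions\<close>

text \<open>\<open>partrec\<close> fixes a function on lists of every length, where its behaviour is
  accidental. Comparing on lists of length \<open>k\<close> only allows rewriting by
  \<open>prec_cong\<close>.\<close>

definition prec :: "nat \<Rightarrow> (nat list \<Rightarrow> nat option) \<Rightarrow> bool" where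
  "prec k f \<longleftrightarrow> (\<exists>r. partrec k r \<and> (\<forall>xs. length xs = k \<longrightarrow> r xs = f xs))"

abbreviation trec :: "nat \<Rightarrow> (nat list \<Rightarrow> nat) \<Rightarrow> bool" where
  "trec k f \<equiv> prec k (\<lambda>xs. Some (f xs))"

lemma partrec_imp_prec: "partrec k f \<Longrightarrow> prec k f"
  by (auto simp: prec_def)

lemma prec_cong:
  assumes "prec k f" "\<And>xs. length xs = k \<Longrightarrow> f xs = g xs"
  shows "prec k g"
  using assms by (auto simp: prec_def)

lemma length_those: "those xs = Some ys \<Longrightarrow> length ys = length xs"
  by (induction xs arbitrary: ys) (auto split: option.splits)

lemma those_Some: "those (map (\<lambda>x. Some (f x)) xs) = Some (map f xs)"
  by (induction xs) auto

lemma prec_comp: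
  assumes "prec (length gs) f" "\<forall>g \<in> set gs. prec k g"
  shows "prec k (\<lambda>xs. Option.bind (those (map (\<lambda>g. g xs) gs)) f)"
proof -
  obtain rf where rf: "partrec (length gs) rf" "\<And>xs. length xs = length gs \<Longrightarrow> rf xs = f xs"
    using assms(1) by (auto simp: prec_def)
  obtain c where c: "\<forall>g \<in> set gs. partrec k (c g) \<and> (\<forall>xs. length xs = k \<longrightarrow> c g xs = g xs)"
    using assms(2) unfolding prec_def by metis
  have "partrec k (\<lambda>xs. Option.bind (those (map (\<lambda>g. g xs) (map c gs))) rf)"
    using rf c by (intro partrec.comp) auto
  moreover have "Option.bind (those (map (\<lambda>g. g xs) (map c gs))) rf =
      Option.bind (those (map (\<lambda>g. g xs) gs)) f" if "length xs = k" for xs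
  proof -
    have "map (\<lambda>g. g xs) (map c gs) = map (\<lambda>g. g xs) gs"
      using c that by auto
    then show ?thesis
      using rf(2) unfolding \<open>map _ (map c gs) = _\<close>
      by (cases "those (map (\<lambda>g. g xs) gs)") (auto dest: length_those)
  qed
  ultimately show ?thesis
    by (auto simp: prec_def)
qed

lemma prec_comp_total:
  assumes "prec (length gs) f" "\<forall>g \<in> set gs. trec k g"
  shows "prec k (\<lambda>xs. f (map (\<lambda>g. g xs) gs))"
proof -
  let ?gs = "map (\<lambda>g xs. Some (g xs)) gs"
  have "prec k (\<lambda>xs. Option.bind (those (map (\<lambda>g. g xs) ?gs)) f)"
    using assms by (intro prec_comp) auto
  then show ?thesis
    by (simp add: comp_def those_Some)
qed

lemma trec_nth: "i < k \<Longrightarrow> trec k (\<lambda>xs. xs ! i)"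
  by (intro partrec_imp_prec partrec.proj)

lemma trec_nth_tl:
  assumes "Suc i < k" shows "trec k (\<lambda>xs. tl xs ! i)"
  using assms by (intro prec_cong[OF trec_nth[of "Suc i"]]) (auto simp: nth_tl)

lemma trec_hd:
  assumes "0 < k" shows "trec k hd"
  using assms by (intro prec_cong[OF trec_nth[of 0]]) (auto simp: hd_conv_nth)

text \<open>Composition wants one function per argument, so the untouched tail is supplied by the
  projections with indices \<open>d\<close> to \<open>k - 1\<close>. Dropping, inserting or
  permuting leading arguments are instances.\<close>

lemma prec_args:
  assumes "prec m f" "\<forall>a \<in> set as. trec k a" "m = length as + (k - d)"
  shows "prec k (\<lambda>xs. f (map (\<lambda>a. a xs) as @ drop d xs))"
proof (rule prec_cong)
  show "prec k (\<lambda>xs. f (map (\<lambda>a. a xs) (as @ map (\<lambda>i xs. xs ! i) [d..<k])))"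
    using assms by (intro prec_comp_total) (auto simp: trec_nth)
  show "f (map (\<lambda>a. a xs) (as @ map (\<lambda>i xs. xs ! i) [d..<k])) =
      f (map (\<lambda>a. a xs) as @ drop d xs)" if "length xs = k" for xs
  proof -
    have "map (\<lambda>i. xs ! i) [d..<k] = drop d xs"
      using that by (auto simp: list_eq_iff_nth_eq)
    then show ?thesis
      by (simp add: comp_def)
  qed
qed

lemma prec_drop:
  assumes "prec k f" "m = k + d"
  shows "prec m (\<lambda>xs. f (drop d xs))"
proof -
  have "k = length [] + (m - d)"
    using assms(2) by simp
  from prec_args[OF assms(1) _ this] show ?thesis
    by simp
qed

lemma prec_Cons:
  assumes "prec (Suc k) f" "trec k a"
  shows "prec k (\<lambda>xs. f (a xs # xs))"
proof -
  have "Suc k = length [a] + (k - 0)"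
    by simp
  from prec_args[OF assms(1) _ this] assms(2) show ?thesis
    by simp
qed

text \<open>Composition is strict: with \<open>f\<close> placed in front of the projections,
  \<open>g\<close> sees the value of \<open>f\<close> and all original arguments, and the result
  diverges wherever \<open>f\<close> does.\<close>

lemma prec_bind:
  assumes "prec k f" "prec (Suc k) (\<lambda>ys. g (hd ys) (tl ys))"
  shows "prec k (\<lambda>xs. Option.bind (f xs) (\<lambda>y. g y xs))"
proof (rule prec_cong)
  let ?gs = "f # map (\<lambda>i xs. Some (xs ! i)) [0..<k]"
  show "prec k (\<lambda>xs. Option.bind (those (map (\<lambda>g. g xs) ?gs)) (\<lambda>ys. g (hd ys) (tl ys)))"
    using assms by (intro prec_comp) (auto simp: trec_nth)
  show "Option.bind (those (map (\<lambda>g. g xs) ?gs)) (\<lambda>ys. g (hd ys) (tl ys)) =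
      Option.bind (f xs) (\<lambda>y. g y xs)" if "length xs = k" for xs
    using that
    by (cases "f xs") (auto simp: comp_def those_Some map_nth)
qed

lemma prec_app1:
  assumes "prec 1 (\<lambda>ys. f (ys ! 0))" "trec k a"
  shows "prec k (\<lambda>xs. f (a xs))"
  using prec_comp_total[of "[a]" "\<lambda>ys. f (ys ! 0)" k] assms by simp

lemma prec_app2:
  assumes "prec 2 (\<lambda>ys. f (ys ! 0) (ys ! 1))" "trec k a" "trec k b"
  shows "prec k (\<lambda>xs. f (a xs) (b xs))"
  using prec_comp_total[of "[a, b]" "\<lambda>ys. f (ys ! 0) (ys ! 1)" k] assms
  by (simp add: numeral_2_eq_2)

lemma trec_Suc: "trec k a \<Longrightarrow> trec k (\<lambda>xs. Suc (a xs))"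
proof (rule prec_app1[of "\<lambda>x. Some (Suc x)"])
  show "trec 1 (\<lambda>ys. Suc (ys ! 0))"
    by (rule prec_cong[OF partrec_imp_prec[OF partrec.succ]]) (auto simp: length_Suc_conv)
qed

lemma trec_const: "trec k (\<lambda>xs. c)"
  by (induction c) (auto intro: partrec_imp_prec partrec.zero trec_Suc)

text \<open>The rule \<open>partrec.prim\<close> takes its counter from the head of the list and
  hides it from the parameters. Prepending \<open>n xs\<close> keeps all of \<open>xs\<close>
  available to \<open>a\<close> and \<open>g\<close>.\<close>

lemma prec_rec:
  assumes "prec k a" "prec (Suc (Suc k)) (\<lambda>ys. g (ys ! 0) (ys ! 1) (drop 2 ys))" "trec k n"
  shows "prec k (\<lambda>xs. rec_nat (a xs) (\<lambda>m r. Option.bind r (\<lambda>y. g m y xs)) (n xs))"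
proof -
  obtain ra where ra: "partrec k ra" "\<And>xs. length xs = k \<Longrightarrow> ra xs = a xs"
    using assms(1) by (auto simp: prec_def)
  obtain rg where rg: "partrec (Suc (Suc k)) rg"
    "\<And>ys. length ys = Suc (Suc k) \<Longrightarrow> rg ys = g (ys ! 0) (ys ! 1) (drop 2 ys)"
    using assms(2) by (auto simp: prec_def)
  have "rec_nat (ra xs) (\<lambda>m r. Option.bind r (\<lambda>y. rg (m # y # xs))) i =
      rec_nat (a xs) (\<lambda>m r. Option.bind r (\<lambda>y. g m y xs)) i" if "length xs = k" for xs i
    using ra(2) rg(2) that by (induction i) auto
  then show ?thesis
    using prec_Cons[OF partrec_imp_prec[OF partrec.prim[OF ra(1) rg(1)]] assms(3)]
    by (elim prec_cong) auto
qed

lemma trec_rec: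
  assumes "trec k a" "trec (Suc (Suc k)) (\<lambda>ys. g (ys ! 0) (ys ! 1) (drop 2 ys))" "trec k n"
  shows "trec k (\<lambda>xs. rec_nat (a xs) (\<lambda>m r. g m r xs) (n xs))"
proof (rule prec_cong[OF prec_rec[OF assms]])
  have "rec_nat (Some (a xs)) (\<lambda>m r. Option.bind r (\<lambda>y. Some (g m y xs))) i =
      Some (rec_nat (a xs) (\<lambda>m r. g m r xs) i)" for xs i
    by (induction i) auto
  then show "rec_nat (Some (a xs)) (\<lambda>m r. Option.bind r (\<lambda>y. Some (g m y xs))) (n xs) =
      Some (rec_nat (a xs) (\<lambda>m r. g m r xs) (n xs))" for xs .
qed

text \<open>As \<open>f\<close> is total, the condition of \<open>partrec.mini\<close> that all
  smaller values be defined holds automatically.\<close>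

lemma prec_least:
  assumes "trec (Suc k) (\<lambda>ys. f (ys ! 0) (tl ys))"
  shows "prec k (\<lambda>xs. if \<exists>z. f z xs = 0 then Some (LEAST z. f z xs = 0) else None)"
proof -
  obtain r where r: "partrec (Suc k) r"
    "\<And>ys. length ys = Suc k \<Longrightarrow> r ys = Some (f (ys ! 0) (tl ys))"
    using assms by (auto simp: prec_def)
  show ?thesis
    by (rule prec_cong[OF partrec_imp_prec[OF partrec.mini[OF r(1)]]]) (auto simp: r(2))
qed

lemma trec_least:
  assumes "trec (Suc k) (\<lambda>ys. f (ys ! 0) (tl ys))" "\<And>xs. \<exists>z. f z xs = 0"
  shows "trec k (\<lambda>xs. LEAST z. f z xs = 0)"
  using prec_least[OF assms(1)] assms(2) by simp

section \<open>Arithmetic and codes of lists\<close>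

lemma trec_pred: "trec k a \<Longrightarrow> trec k (\<lambda>xs. a xs - 1)"
proof -
  assume "trec k a"
  then have "trec k (\<lambda>xs. rec_nat 0 (\<lambda>m r. m) (a xs))"
    by (intro trec_rec trec_const trec_nth) auto
  moreover have "rec_nat 0 (\<lambda>m r. m) n = n - 1" for n :: nat
    by (cases n) auto
  ultimately show ?thesis by simp
qed

lemma trec_add: "trec k a \<Longrightarrow> trec k b \<Longrightarrow> trec k (\<lambda>xs. a xs + b xs)"
proof -
  assume "trec k a" "trec k b"
  then have "trec k (\<lambda>xs. rec_nat (b xs) (\<lambda>m r. Suc r) (a xs))"
    by (intro trec_rec trec_Suc trec_nth) auto
  moreover have "rec_nat j (\<lambda>m r. Suc r) i = i + j" for i j :: nat
    by (induction i) auto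
  ultimately show ?thesis by simp
qed

lemma trec_diff: "trec k a \<Longrightarrow> trec k b \<Longrightarrow> trec k (\<lambda>xs. a xs - b xs)"
proof -
  assume "trec k a" "trec k b"
  then have "trec k (\<lambda>xs. rec_nat (a xs) (\<lambda>m r. r - 1) (b xs))"
    by (intro trec_rec trec_pred trec_nth) auto
  moreover have "rec_nat j (\<lambda>m r. r - 1) i = j - i" for i j :: nat
    by (induction i) auto
  ultimately show ?thesis by simp
qed

lemma trec_if_zero:
  assumes "trec k c" "trec k a" "trec k b"
  shows "trec k (\<lambda>xs. if c xs = 0 then a xs else b xs)"
proof -
  have "trec k (\<lambda>xs. rec_nat (a xs) (\<lambda>m r. b xs) (c xs))"
    using assms by (intro trec_rec prec_drop) auto
  moreover have "rec_nat x (\<lambda>m r. y) i = (if i = 0 then x else y)" for x y i :: nat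
    by (cases i) auto
  ultimately show ?thesis by simp
qed

lemma trec_if_eq:
  assumes "trec k c" "trec k d" "trec k a" "trec k b"
  shows "trec k (\<lambda>xs. if c xs = d xs then a xs else b xs)"
proof -
  have "trec k (\<lambda>xs. if (c xs - d xs) + (d xs - c xs) = 0 then a xs else b xs)"
    using assms by (intro trec_if_zero trec_add trec_diff)
  moreover have "(x - y) + (y - x) = 0 \<longleftrightarrow> x = y" for x y :: nat
    by auto
  ultimately show ?thesis by simp
qed

lemma trec_if_less:
  assumes "trec k c" "trec k d" "trec k a" "trec k b"
  shows "trec k (\<lambda>xs. if c xs < d xs then a xs else b xs)"
proof -
  have "trec k (\<lambda>xs. if Suc (c xs) - d xs = 0 then a xs else b xs)"
    using assms by (intro trec_if_zero trec_Suc trec_diff)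
  then show ?thesis by (simp add: Suc_le_eq)
qed

section \<open>Cantor pairing and its inverse\<close>

lemma trec_triangle: "trec k a \<Longrightarrow> trec k (\<lambda>xs. triangle (a xs))"
proof -
  assume "trec k a"
  then have "trec k (\<lambda>xs. rec_nat 0 (\<lambda>m r. r + Suc m) (a xs))"
    by (intro trec_rec trec_add trec_Suc trec_const trec_nth) auto
  moreover have "rec_nat 0 (\<lambda>m r. r + Suc m) i = triangle i" for i
    by (induction i) auto
  ultimately show ?thesis by simp
qed

lemma trec_prod_encode:
  assumes "trec k a" "trec k b"
  shows "trec k (\<lambda>xs. prod_encode (a xs, b xs))"
  using assms unfolding prod_encode_def by (auto intro!: trec_add trec_triangle)

lemma triangle_mono: "m \<le> n \<Longrightarrow> triangle m \<le> triangle n"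
  by (induction n) (auto simp: le_Suc_eq)

text \<open>Pairs with \<open>m + n = d\<close> fill the codes from \<open>triangle d\<close> up to,
  but excluding, \<open>triangle (Suc d)\<close>. So a search finds the diagonal of a code, and both
  components follow by subtraction.\<close>

lemma least_diagonal: "(LEAST d. prod_encode (m, n) < triangle (Suc d)) = m + n"
proof (rule Least_equality)
  show "m + n \<le> d" if "prod_encode (m, n) < triangle (Suc d)" for d
  proof (rule ccontr)
    assume "\<not> m + n \<le> d"
    then have "triangle (Suc d) \<le> triangle (m + n)"
      by (intro triangle_mono) simp
    then show False
      using that by (simp add: prod_encode_def)
  qed
qed (simp add: prod_encode_def)

lemma trec_diagonal:
  assumes "trec k a"
  shows "trec k (\<lambda>xs. LEAST d. a xs < triangle (Suc d))"
proof -
  have "trec 1 (\<lambda>xs. LEAST d. (if xs ! 0 < triangle (Suc d) then 0 else 1) = (0 :: nat))"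
  proof (rule trec_least)
    show "\<exists>d. (if xs ! 0 < triangle (Suc d) then 0 else 1) = (0 :: nat)" for xs :: "nat list"
      by (rule exI[of _ "xs ! 0"]) simp
    show "trec (Suc 1) (\<lambda>ys. if tl ys ! 0 < triangle (Suc (ys ! 0)) then 0 else 1)"
      by (intro trec_if_less trec_triangle trec_Suc trec_const trec_nth trec_nth_tl) auto
  qed
  moreover have "((if P then 0 else 1) = (0 :: nat)) = P" for P
    by simp
  ultimately have "trec 1 (\<lambda>xs. LEAST d. xs ! 0 < triangle (Suc d))"
    by (simp only:)
  then show ?thesis
    using prec_app1[of "\<lambda>x. Some (LEAST d. x < triangle (Suc d))"] assms by simp
qed

lemma trec_fst:
  assumes "trec k a"
  shows "trec k (\<lambda>xs. fst (prod_decode (a xs)))"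
proof (rule prec_cong)
  show "trec k (\<lambda>xs. a xs - triangle (LEAST d. a xs < triangle (Suc d)))"
    using assms by (intro trec_diff trec_triangle trec_diagonal)
  fix xs :: "nat list"
  obtain m n where "a xs = prod_encode (m, n)"
    by (metis prod_decode_inverse surj_pair)
  then show "Some (a xs - triangle (LEAST d. a xs < triangle (Suc d))) =
      Some (fst (prod_decode (a xs)))"
    by (simp only: least_diagonal prod_encode_inverse) (simp add: prod_encode_def)
qed

lemma trec_snd:
  assumes "trec k a"
  shows "trec k (\<lambda>xs. snd (prod_decode (a xs)))"
proof (rule prec_cong)
  show "trec k (\<lambda>xs. (LEAST d. a xs < triangle (Suc d)) - fst (prod_decode (a xs)))"
    using assms by (intro trec_diff trec_fst trec_diagonal)
  fix xs :: "nat list"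
  obtain m n where "a xs = prod_encode (m, n)"
    by (metis prod_decode_inverse surj_pair)
  then show "Some ((LEAST d. a xs < triangle (Suc d)) - fst (prod_decode (a xs))) =
      Some (snd (prod_decode (a xs)))"
    by (simp only: least_diagonal) simp
qed

section \<open>Codes of lists\<close>

definition cons_code :: "nat \<Rightarrow> nat \<Rightarrow> nat" where
  "cons_code x c = Suc (prod_encode (x, c))"

definition hd_code :: "nat \<Rightarrow> nat" where
  "hd_code c = fst (prod_decode (c - 1))"

definition tl_code :: "nat \<Rightarrow> nat" where
  "tl_code c = snd (prod_decode (c - 1))"

definition drop_code :: "nat \<Rightarrow> nat \<Rightarrow> nat" where
  "drop_code n c = rec_nat c (\<lambda>_. tl_code) n"

text \<open>The code \<open>c\<close> itself is the number of rounds, as it bounds the length of the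
  list. Once the list is exhausted, \<open>drop_code j c\<close> is 0, the code of the empty list,
  and the accumulator stays fixed.\<close>

definition rev_code :: "nat \<Rightarrow> nat" where
  "rev_code c = rec_nat 0 (\<lambda>j acc.
     if drop_code j c = 0 then acc else cons_code (hd_code (drop_code j c)) acc) c"

definition pad_code :: "nat \<Rightarrow> nat \<Rightarrow> nat" where
  "pad_code n c = rec_nat c (\<lambda>_. cons_code 0) n"

lemma cons_code: "cons_code x (list_encode xs) = list_encode (x # xs)"
  by (simp add: cons_code_def)

lemma drop_code: "drop_code n (list_encode xs) = list_encode (drop n xs)"
proof (induction n)
  case (Suc n)
  \<comment> \<open>This gives \<open>tl_code 0 = 0\<close>, in agreement with
    \<open>tl [] = []\<close>.\<close>
  have "prod_decode 0 = (0, 0)"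
    using prod_encode_inverse[of "(0, 0)"] by (simp add: prod_encode_def)
  then have "tl_code (list_encode ys) = list_encode (tl ys)" for ys
    by (cases ys) (auto simp: tl_code_def)
  with Suc show ?case
    by (simp add: drop_code_def tl_drop drop_Suc)
qed (simp add: drop_code_def)

lemma length_le_list_encode: "length xs \<le> list_encode xs"
proof (induction xs)
  case (Cons x xs)
  then show ?case
    using le_prod_encode_2[of "list_encode xs" x] by simp
qed simp

lemma rev_code: "rev_code (list_encode xs) = list_encode (rev xs)"
proof -
  have "rec_nat 0 (\<lambda>j acc. if drop_code j c = 0 then acc
      else cons_code (hd_code (drop_code j c)) acc) n = list_encode (rev (take n xs))"
    if "c = list_encode xs" for c n
  proof (induction n)
    case (Suc n)
    show ?case
    proof (cases "n < length xs")
      case True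
      then have "drop n xs = xs ! n # drop (Suc n) xs" "take (Suc n) xs = take n xs @ [xs ! n]"
        by (auto simp: Cons_nth_drop_Suc take_Suc_conv_app_nth)
      with Suc that show ?thesis
        by (simp add: drop_code hd_code_def cons_code_def)
    qed (use Suc that in \<open>simp add: drop_code\<close>)
  qed simp
  then show ?thesis
    by (simp add: rev_code_def length_le_list_encode)
qed

lemma pad_code: "pad_code n (list_encode xs) = list_encode (replicate n 0 @ xs)"
  by (induction n) (auto simp: pad_code_def cons_code)

lemma trec_cons_code: "trec k a \<Longrightarrow> trec k b \<Longrightarrow> trec k (\<lambda>xs. cons_code (a xs) (b xs))"
  unfolding cons_code_def by (intro trec_Suc trec_prod_encode)

lemma trec_hd_code: "trec k a \<Longrightarrow> trec k (\<lambda>xs. hd_code (a xs))"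
  unfolding hd_code_def by (intro trec_fst trec_pred)

lemma trec_tl_code: "trec k a \<Longrightarrow> trec k (\<lambda>xs. tl_code (a xs))"
  unfolding tl_code_def by (intro trec_snd trec_pred)

lemma trec_drop_code: "trec k a \<Longrightarrow> trec k b \<Longrightarrow> trec k (\<lambda>xs. drop_code (a xs) (b xs))"
  unfolding drop_code_def by (intro trec_rec trec_tl_code trec_nth) auto

lemma trec_pad_code: "trec k a \<Longrightarrow> trec k b \<Longrightarrow> trec k (\<lambda>xs. pad_code (a xs) (b xs))"
  unfolding pad_code_def by (intro trec_rec trec_cons_code trec_const trec_nth) auto

lemma trec_rev_code: "trec k a \<Longrightarrow> trec k (\<lambda>xs. rev_code (a xs))"
  unfolding rev_code_def
  by (intro trec_rec trec_if_zero trec_cons_code trec_hd_code trec_drop_code trec_const trec_nth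
      prec_drop[where f = "\<lambda>xs. Some (a xs)"]) auto

section \<open>Computations with a bounded number of steps\<close>

text \<open>\<open>F (s # xs)\<close> is the successor of the value \<open>f xs\<close> if the computation takes at most
  \<open>s\<close> steps, and \<open>0\<close> otherwise. Monotonicity in \<open>s\<close> is not required.\<close>

definition stages :: "nat \<Rightarrow> (nat list \<Rightarrow> nat option) \<Rightarrow> (nat list \<Rightarrow> nat) \<Rightarrow> bool" where
  "stages k f F \<longleftrightarrow> trec (Suc k) F \<and> (\<forall>xs y. length xs = k \<longrightarrow>
     (\<forall>s. F (s # xs) = Suc y \<longrightarrow> f xs = Some y) \<and>
     (f xs = Some y \<longrightarrow> (\<forall>\<^sub>F s in sequentially. F (s # xs) = Suc y)))"

lemma stages_trec: "stages k f F \<Longrightarrow> trec (Suc k) F"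
  by (simp add: stages_def)

lemma stages_sound: "stages k f F \<Longrightarrow> length xs = k \<Longrightarrow> F (s # xs) = Suc y \<Longrightarrow> f xs = Some y"
  unfolding stages_def by blast

lemma stages_complete:
  "stages k f F \<Longrightarrow> length xs = k \<Longrightarrow> f xs = Some y \<Longrightarrow>
    \<forall>\<^sub>F s in sequentially. F (s # xs) = Suc y"
  by (simp add: stages_def)

lemma stagesI:
  assumes "trec (Suc k) F"
    "\<And>xs s y. length xs = k \<Longrightarrow> F (s # xs) = Suc y \<Longrightarrow> f xs = Some y"
    "\<And>xs y. length xs = k \<Longrightarrow> f xs = Some y \<Longrightarrow> \<forall>\<^sub>F s in sequentially. F (s # xs) = Suc y"
  shows "stages k f F"
  using assms by (simp add: stages_def)

lemma stages_total:
  assumes "trec k f" shows "\<exists>F. stages k (\<lambda>xs. Some (f xs)) F"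
proof
  have "trec (Suc k) (\<lambda>ys. Suc (f (drop 1 ys)))"
    using assms by (intro trec_Suc prec_drop[where f = "\<lambda>xs. Some (f xs)"]) auto
  then show "stages k (\<lambda>xs. Some (f xs)) (\<lambda>ys. Suc (f (drop 1 ys)))"
    by (rule stagesI) simp_all
qed

lemma trec_all_nonzero:
  assumes "\<forall>g \<in> set gs. trec k (c g)"
  shows "trec k (\<lambda>xs. if \<forall>g \<in> set gs. c g xs \<noteq> 0 then 1 else 0)"
  using assms
proof (induction gs)
  case (Cons g gs)
  then have "trec k (\<lambda>xs. if c g xs = 0 then 0 else if \<forall>g \<in> set gs. c g xs \<noteq> 0 then 1 else 0)"
    by (intro trec_if_zero trec_const) auto
  then show ?case
    by (elim prec_cong) auto
qed (simp add: trec_const)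

text \<open>All functions get the same bound \<open>s\<close>. As \<open>gs\<close> is finite, from
  some \<open>s\<close> on all inner results are present at once, and so is the outer result at
  these fixed values.\<close>

lemma stages_comp:
  assumes "stages (length gs) f F" "\<forall>g \<in> set gs. \<exists>G. stages k g G"
  shows "\<exists>H. stages k (\<lambda>xs. Option.bind (those (map (\<lambda>g. g xs) gs)) f) H"
proof -
  obtain c where c: "\<forall>g \<in> set gs. stages k g (c g)"
    using assms(2) by metis
  \<comment> \<open>The entry \<open>hd\<close> hands the bound \<open>s\<close> on to
    \<open>F\<close>; the predecessor strips the success marker from each inner result.\<close>
  define H where "H ys = (if (if \<forall>g \<in> set gs. c g ys \<noteq> 0 then 1 else 0) = (0 :: nat) then 0
    else F (map (\<lambda>a. a ys) (hd # map (\<lambda>g ys. c g ys - 1) gs)))" for ys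
  have H: "H (s # xs) = (if \<forall>g \<in> set gs. c g (s # xs) \<noteq> 0
      then F (s # map (\<lambda>g. c g (s # xs) - 1) gs) else 0)" for s xs
    by (auto simp: H_def comp_def)
  have "stages k (\<lambda>xs. Option.bind (those (map (\<lambda>g. g xs) gs)) f) H"
  proof (rule stagesI)
    show "trec (Suc k) H"
      unfolding H_def using c assms(1)
      by (intro trec_if_zero trec_all_nonzero trec_const
          prec_comp_total[where f = "\<lambda>xs. Some (F xs)"]) (auto intro: stages_trec intro!: trec_hd trec_pred[simplified])
  next
    fix xs s y
    assume xs: "length xs = k" and H_y: "H (s # xs) = Suc y"
    then have F_y: "F (s # map (\<lambda>g. c g (s # xs) - 1) gs) = Suc y"
      and nz: "\<forall>g \<in> set gs. c g (s # xs) \<noteq> 0"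
      by (auto simp: H split: if_splits)
    have "g xs = Some (c g (s # xs) - 1)" if "g \<in> set gs" for g
      using c nz that xs by (intro stages_sound[of k g "c g" xs s]) auto
    then have "map (\<lambda>g. g xs) gs = map (\<lambda>g. Some (c g (s # xs) - 1)) gs"
      by simp
    then show "Option.bind (those (map (\<lambda>g. g xs) gs)) f = Some y"
      using stages_sound[OF assms(1) _ F_y] by (simp only: those_Some) simp
  next
    fix xs y
    assume xs: "length xs = k" and y: "Option.bind (those (map (\<lambda>g. g xs) gs)) f = Some y"
    then obtain vs where vs: "those (map (\<lambda>g. g xs) gs) = Some vs" and f_vs: "f vs = Some y"
      by (auto simp: bind_eq_Some_conv)
    have "\<forall>g \<in> set gs. g xs \<noteq> None"
      using vs by (induction gs arbitrary: vs) (auto split: option.splits)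
    moreover have "vs = map (\<lambda>g. the (g xs)) gs"
      using vs by (induction gs arbitrary: vs) (auto split: option.splits)
    ultimately have val: "\<forall>g \<in> set gs. g xs = Some (the (g xs))"
      and vs_eq: "vs = map (\<lambda>g. the (g xs)) gs"
      by auto
    have "\<forall>\<^sub>F s in sequentially. \<forall>g \<in> set gs. c g (s # xs) = Suc (the (g xs))"
      using c val xs by (intro eventually_ball_finite) (auto intro: stages_complete)
    moreover have "\<forall>\<^sub>F s in sequentially. F (s # vs) = Suc y"
      using stages_complete[OF assms(1) _ f_vs] vs_eq by simp
    ultimately show "\<forall>\<^sub>F s in sequentially. H (s # xs) = Suc y"
    proof eventually_elim
      case (elim s)
      then have "map (\<lambda>g. c g (s # xs) - 1) gs = vs"
        by (simp add: vs_eq)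
      with elim show ?case
        by (simp add: H)
    qed
  qed
  then show ?thesis
    by blast
qed

text \<open>One bound \<open>s\<close> governs every round, and a failed round makes all later ones
  fail. For a fixed counter only finitely many rounds occur, so eventual correctness carries over by
  induction.\<close>

lemma stages_prim:
  assumes f: "stages k f F" and g: "stages (Suc (Suc k)) g K"
  shows "\<exists>H. stages (Suc k) (\<lambda>xs. rec_nat (f (tl xs))
    (\<lambda>n r. Option.bind r (\<lambda>y. g (n # y # tl xs))) (hd xs)) H"
proof -
  define H where "H ys = rec_nat (F (map (\<lambda>a. a ys) [\<lambda>ys. ys ! 0] @ drop 2 ys))
    (\<lambda>m r. if r = 0 then 0 else K (ys ! 0 # m # (r - 1) # drop 2 ys)) (ys ! 1)" for ys
  have H: "H (s # n # xs) = rec_nat (F (s # xs))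
      (\<lambda>m r. if r = 0 then 0 else K (s # m # (r - 1) # xs)) n" for s n xs
    by (simp add: H_def cong: if_cong)
  let ?f = "\<lambda>n xs. rec_nat (f xs) (\<lambda>n r. Option.bind r (\<lambda>y. g (n # y # xs))) n"
  have "stages (Suc k) (\<lambda>xs. ?f (hd xs) (tl xs)) H"
  proof (rule stagesI)
    \<comment> \<open>The list \<open>zs\<close> consists of the counter, the previous marked
      result, \<open>s\<close>, the recursion argument and the parameters, whereas \<open>K\<close>
      expects \<open>s\<close> first.\<close>
    let ?as = "[\<lambda>zs. zs ! 2, \<lambda>zs. zs ! 0, \<lambda>zs. zs ! 1 - 1]"
    have "trec (Suc (Suc (Suc (Suc k)))) (\<lambda>zs. K (map (\<lambda>a. a zs) ?as @ drop 4 zs))"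
      using stages_trec[OF g] by (intro prec_args[where f = "\<lambda>xs. Some (K xs)"])
        (auto intro!: trec_nth trec_pred[simplified])
    then have "trec (Suc (Suc (Suc (Suc k))))
        (\<lambda>zs. K (drop 2 zs ! 0 # zs ! 0 # (zs ! 1 - 1) # drop 2 (drop 2 zs)))"
      by (elim prec_cong) simp
    moreover have "trec (Suc (Suc k)) (\<lambda>ys. F (map (\<lambda>a. a ys) [\<lambda>ys. ys ! 0] @ drop 2 ys))"
      using stages_trec[OF f] by (intro prec_args[where f = "\<lambda>xs. Some (F xs)"])
        (auto intro!: trec_nth)
    ultimately show "trec (Suc (Suc k)) H"
      unfolding H_def by (intro trec_rec trec_if_zero trec_nth trec_const) auto
  next
    have "H (s # n # xs) = Suc y \<Longrightarrow> ?f n xs = Some y" if "length xs = k" for s n xs y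
    proof (induction n arbitrary: y)
      case 0
      then show ?case
        using stages_sound[OF f that] by (simp add: H)
    next
      case (Suc n)
      then have "H (s # n # xs) \<noteq> 0" and K: "K (s # n # (H (s # n # xs) - 1) # xs) = Suc y"
        by (auto simp: H split: if_splits)
      then have "?f n xs = Some (H (s # n # xs) - 1)"
        by (intro Suc.IH) simp
      moreover have "g (n # (H (s # n # xs) - 1) # xs) = Some y"
        using stages_sound[OF g _ K] that by simp
      ultimately show ?case
        by simp
    qed
    then show "?f (hd xs) (tl xs) = Some y" if "length xs = Suc k" "H (s # xs) = Suc y" for xs s y
      using that by (cases xs) auto
  next
    have "?f n xs = Some y \<Longrightarrow> \<forall>\<^sub>F s in sequentially. H (s # n # xs) = Suc y"
      if "length xs = k" for n xs y
    proof (induction n arbitrary: y)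
      case 0
      then show ?case
        using stages_complete[OF f that] by (simp add: H)
    next
      case (Suc n)
      then obtain z where z: "?f n xs = Some z" "g (n # z # xs) = Some y"
        by (auto simp: bind_eq_Some_conv)
      have "\<forall>\<^sub>F s in sequentially. K (s # n # z # xs) = Suc y"
        using stages_complete[OF g _ z(2)] that by simp
      with Suc.IH[OF z(1)] show ?case
        by eventually_elim (simp add: H)
    qed
    then show "\<forall>\<^sub>F s in sequentially. H (s # xs) = Suc y"
      if "length xs = Suc k" "?f (hd xs) (tl xs) = Some y" for xs y
      using that by (cases xs) auto
  qed
  then show ?thesis
    by blast
qed

text \<open>Within bound \<open>s\<close> the search stops at the first candidate where
  \<open>f\<close> has value 0 or has not yet halted, and succeeds only in the former case. So no
  candidate is skipped while its computation is unfinished.\<close>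

lemma stages_mini:
  assumes f: "stages (Suc k) f F"
  shows "\<exists>H. stages k (\<lambda>xs. if \<exists>z. f (z # xs) = Some 0 \<and> (\<forall>y<z. f (y # xs) \<noteq> None)
    then Some (LEAST z. f (z # xs) = Some 0) else None) H"
proof -
  \<comment> \<open>Truncated subtraction makes \<open>F - 1 = 0\<close> cover both
    \<open>F = 0\<close> (not halted) and \<open>F = 1\<close> (value 0). The cutoff at
    \<open>s\<close> makes the search total.\<close>
  define P where "P z ys \<longleftrightarrow> (if z < ys ! 0 then F (ys ! 0 # z # drop 1 ys) - 1 else 0) = 0" for z ys
  define m where "m ys = (LEAST z. P z ys)" for ys
  define H where "H ys = (if F (ys ! 0 # m ys # drop 1 ys) = 1 then Suc (m ys) else 0)" for ys
  have P_ex: "P (ys ! 0) ys" for ys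
    by (simp add: P_def)
  have m_least: "\<not> P z ys" if "z < m ys" for z ys
    using that not_less_Least unfolding m_def by blast
  have m_le: "m ys \<le> ys ! 0" for ys
    unfolding m_def using P_ex by (rule Least_le)
  let ?f = "\<lambda>xs. if \<exists>z. f (z # xs) = Some 0 \<and> (\<forall>y<z. f (y # xs) \<noteq> None)
    then Some (LEAST z. f (z # xs) = Some 0) else None"
  have "stages k ?f H"
  proof (rule stagesI)
    have m: "trec (Suc k) m"
      unfolding m_def P_def
    proof (rule trec_least)
      let ?as = "[\<lambda>zs. zs ! 1, \<lambda>zs. zs ! 0]"
      have "trec (Suc (Suc k)) (\<lambda>zs. F (map (\<lambda>a. a zs) ?as @ drop 2 zs))"
        using stages_trec[OF f] by (intro prec_args[where f = "\<lambda>xs. Some (F xs)"])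
          (auto intro!: trec_nth)
      then have "trec (Suc (Suc k)) (\<lambda>zs. F (tl zs ! 0 # zs ! 0 # drop 1 (tl zs)))"
        by (elim prec_cong) (auto simp: nth_tl drop_Suc numeral_2_eq_2)
      then show "trec (Suc (Suc k)) (\<lambda>zs. if zs ! 0 < tl zs ! 0
          then F (tl zs ! 0 # zs ! 0 # drop 1 (tl zs)) - 1 else 0)"
        by (intro trec_if_less trec_nth trec_nth_tl trec_pred trec_const) auto
      show "\<exists>z. (if z < ys ! 0 then F (ys ! 0 # z # drop 1 ys) - 1 else 0) = 0" for ys
        using P_ex[of ys] unfolding P_def by blast
    qed
    have "trec (Suc k) (\<lambda>ys. F (map (\<lambda>a. a ys) [\<lambda>ys. ys ! 0, m] @ drop 1 ys))"
      using stages_trec[OF f] m by (intro prec_args[where f = "\<lambda>xs. Some (F xs)"])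
        (auto intro!: trec_nth)
    then show "trec (Suc k) H"
      unfolding H_def using m by (intro trec_if_eq trec_Suc trec_const) auto
  next
    fix xs s y
    assume xs: "length xs = k" and "H (s # xs) = Suc y"
    then have y: "m (s # xs) = y" and Fy: "F (s # y # xs) = Suc 0"
      by (auto simp: H_def split: if_splits)
    have fy: "f (y # xs) = Some 0"
      using stages_sound[OF f _ Fy] xs by simp
    have below: "\<exists>v. f (z # xs) = Some (Suc v)" if "z < y" for z
    proof -
      have "F (s # z # xs) = Suc (Suc (F (s # z # xs) - 2))"
        using m_least[of z "s # xs"] that y by (auto simp: P_def split: if_splits)
      then show ?thesis
        using stages_sound[OF f] xs by (metis length_Cons)
    qed
    have "y \<le> z" if "f (z # xs) = Some 0" for z
      using below[of z] that by (cases "z < y") auto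
    with fy have "(LEAST z. f (z # xs) = Some 0) = y"
      by (intro Least_equality)
    moreover have "\<forall>z<y. f (z # xs) \<noteq> None"
      using below by fastforce
    ultimately show "?f xs = Some y"
      using fy by auto
  next
    fix xs y
    assume xs: "length xs = k" and fxs: "?f xs = Some y"
    then obtain z where z: "f (z # xs) = Some 0" "\<forall>y<z. f (y # xs) \<noteq> None"
      and y: "y = (LEAST z. f (z # xs) = Some 0)"
      by (auto split: if_splits)
    have fy: "f (y # xs) = Some 0" and "y \<le> z"
      unfolding y using z(1) by (rule LeastI, rule Least_le)
    have below: "f (w # xs) = Some (the (f (w # xs)))" "the (f (w # xs)) \<noteq> 0" if "w < y" for w
    proof -
      have "f (w # xs) \<noteq> None" "f (w # xs) \<noteq> Some 0"
        using z(2) \<open>y \<le> z\<close> that not_less_Least[of w "\<lambda>z. f (z # xs) = Some 0"] by (auto simp: y)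
      then show "f (w # xs) = Some (the (f (w # xs)))" "the (f (w # xs)) \<noteq> 0"
        by auto
    qed
    have "\<forall>\<^sub>F s in sequentially. \<forall>w \<in> {..<y}. F (s # w # xs) = Suc (the (f (w # xs)))"
      using below xs by (intro eventually_ball_finite) (auto intro!: stages_complete[OF f])
    moreover have "\<forall>\<^sub>F s in sequentially. F (s # y # xs) = Suc 0"
      using stages_complete[OF f _ fy] xs by simp
    \<comment> \<open>For such \<open>s\<close>, no \<open>w < y\<close> satisfies \<open>P\<close>
      merely through the cutoff.\<close>
    moreover have "\<forall>\<^sub>F s in sequentially. y < s"
      by (rule eventually_gt_at_top)
    ultimately show "\<forall>\<^sub>F s in sequentially. H (s # xs) = Suc y"
    proof eventually_elim
      case (elim s)
      then have P: "P y (s # xs)"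
        by (simp add: P_def)
      have "\<not> P w (s # xs)" if "w < y" for w
        using elim below(2)[OF that] that by (simp add: P_def)
      with P have "m (s # xs) = y"
        unfolding m_def by (intro Least_equality) (auto simp: not_less[symmetric])
      with elim show ?case
        by (simp add: H_def)
    qed
  qed
  then show ?thesis
    by blast
qed

lemma partrec_stages: "partrec k f \<Longrightarrow> \<exists>F. stages k f F"
proof (induction rule: partrec.induct)
  case (zero k)
  show ?case by (intro stages_total trec_const)
next
  case succ
  have "trec 1 (\<lambda>xs. Suc (hd xs))"
    by (intro trec_Suc trec_hd) simp
  then show ?case by (rule stages_total)
next
  case (proj i k)
  then show ?case by (intro stages_total trec_nth)
qed (blast intro: stages_comp stages_prim stages_mini)+

lemma prec_stages: "prec k f \<Longrightarrow> \<exists>F. stages k f F"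
  unfolding prec_def using partrec_stages by (force simp: stages_def)

text \<open>Dovetailing over \<open>n\<close> and the number of steps.\<close>

lemma prec_select:
  assumes "prec (Suc k) f"
  shows "\<exists>g. prec k g \<and> (\<forall>xs. length xs = k \<longrightarrow>
    (\<forall>n. g xs = Some n \<longrightarrow> f (n # xs) = Some 0) \<and>
    (g xs = None \<longrightarrow> (\<forall>n. f (n # xs) \<noteq> Some 0)))"
proof -
  obtain F where F: "stages (Suc k) f F"
    using prec_stages[OF assms] ..
  \<comment> \<open>A candidate \<open>z\<close> codes a pair of a bound and an argument
    \<open>n\<close>; the value 1 of \<open>F\<close> signals that \<open>f\<close> halts with 0.
    \<open>Q\<close> is total, so divergence of \<open>f\<close> at one \<open>n\<close> cannot
    block the others.\<close>
  define Q where "Q z xs = (if F (fst (prod_decode z) # snd (prod_decode z) # xs) = 1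
    then 0 else 1 :: nat)" for z xs
  define g where "g xs = Option.bind
    (if \<exists>z. Q z xs = 0 then Some (LEAST z. Q z xs = 0) else None)
    (\<lambda>z. Some (snd (prod_decode z)))" for xs
  have "prec k g"
    unfolding g_def
  proof (rule prec_bind, rule prec_least)
    let ?as = "[\<lambda>ys. fst (prod_decode (ys ! 0)), \<lambda>ys. snd (prod_decode (ys ! 0))]"
    have "trec (Suc k) (\<lambda>ys. F (map (\<lambda>a. a ys) ?as @ drop 1 ys))"
      using stages_trec[OF F] by (intro prec_args[where f = "\<lambda>xs. Some (F xs)"])
        (auto intro!: trec_fst trec_snd trec_nth)
    then show "trec (Suc k) (\<lambda>ys. Q (ys ! 0) (tl ys))"
      unfolding Q_def by (intro trec_if_eq trec_const) (auto simp: drop_Suc)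
    show "trec (Suc k) (\<lambda>ys. snd (prod_decode (hd ys)))"
      by (intro trec_snd trec_hd) simp
  qed
  moreover have "f (n # xs) = Some 0" if "length xs = k" "g xs = Some n" for xs n
  proof -
    define z where "z = (LEAST z. Q z xs = 0)"
    from that(2) have ex: "\<exists>z. Q z xs = 0" and n: "n = snd (prod_decode z)"
      by (auto simp: g_def z_def split: if_splits)
    from ex have "Q z xs = 0"
      unfolding z_def by (rule LeastI_ex)
    then have "F (fst (prod_decode z) # n # xs) = Suc 0"
      by (auto simp: Q_def n split: if_splits)
    then show ?thesis
      using stages_sound[OF F] that(1) by simp
  qed
  moreover have "f (n # xs) \<noteq> Some 0" if "length xs = k" "g xs = None" for xs n
  proof
    assume "f (n # xs) = Some 0"
    then have "\<forall>\<^sub>F s in sequentially. F (s # n # xs) = Suc 0"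
      using stages_complete[OF F] that(1) by simp
    then obtain s where "F (s # n # xs) = 1"
      by (auto simp: eventually_sequentially)
    then have "Q (prod_encode (s, n)) xs = 0"
      by (simp add: Q_def)
    then have "\<exists>z. Q z xs = 0" ..
    with that(2) show False
      by (simp add: g_def)
  qed
  ultimately show ?thesis
    by auto
qed

section \<open>Unary and binary computable functions\<close>

lemma partial_computable_iff: "partial_computable f \<longleftrightarrow> prec 1 (\<lambda>xs. f (xs ! 0))"
proof -
  have "(\<forall>x. r [x] = f x) \<longleftrightarrow> (\<forall>xs. length xs = 1 \<longrightarrow> r xs = f (xs ! 0))" for r
    by (auto simp: length_Suc_conv)
  then show ?thesis
    by (simp add: partial_computable_def prec_def)
qed

lemma partial_computable2_iff:
  "partial_computable2 f \<longleftrightarrow> prec 2 (\<lambda>xs. f (xs ! 0) (xs ! 1))"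
proof -
  have "(\<forall>x y. r [x, y] = f x y) \<longleftrightarrow> (\<forall>xs. length xs = 2 \<longrightarrow> r xs = f (xs ! 0) (xs ! 1))" for r
    by (auto simp: length_Suc_conv numeral_2_eq_2)
  then show ?thesis
    by (simp add: partial_computable2_def prec_def)
qed

lemma total_computable_iff: "total_computable f \<longleftrightarrow> trec 1 (\<lambda>xs. f (xs ! 0))"
  by (simp add: total_computable_def partial_computable_iff)

lemma REC_iff: "A \<in> REC \<longleftrightarrow> trec 1 (\<lambda>xs. if xs ! 0 \<in> A then 1 else 0)"
  by (simp add: REC_def total_computable_iff)

lemma finite_in_REC: "finite A \<Longrightarrow> A \<in> REC"
proof (induction rule: finite_induct)
  case empty
  then show ?case
    by (simp add: REC_iff trec_const)
next
  case (insert a A)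
  then have "trec 1 (\<lambda>xs. if xs ! 0 = a then 1 else if xs ! 0 \<in> A then 1 else 0)"
    unfolding REC_iff by (intro trec_if_eq trec_const trec_nth) auto
  then show ?case
    unfolding REC_iff by (elim prec_cong) auto
qed

lemma column_in_REC: "range (\<lambda>k. prod_encode (e, k)) \<in> REC"
proof -
  have "trec 1 (\<lambda>xs. if fst (prod_decode (xs ! 0)) = e then 1 else 0)"
    by (intro trec_if_eq trec_fst trec_const trec_nth) auto
  moreover have "x \<in> range (\<lambda>k. prod_encode (e, k)) \<longleftrightarrow> fst (prod_decode x) = e" for x
  proof
    assume "fst (prod_decode x) = e"
    then have "x = prod_encode (e, snd (prod_decode x))"
      by auto
    then show "x \<in> range (\<lambda>k. prod_encode (e, k))"
      by (rule range_eqI)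
  qed auto
  ultimately show ?thesis
    by (simp add: REC_iff)
qed

section \<open>The diagonal argument\<close>

text \<open>
  The data segments \<open>seg k\<close> approximate a text for \<open>{x k |k. seg k \<noteq> None}\<close>. The element
  \<open>x (Suc k)\<close> enters only when a conjecture of the learner on some \<open>seg k @ replicate n None\<close>
  excludes it; the test also fires for spurious conjectures (the truncated predecessor turns
  \<open>Query\<close> into index \<open>0\<close>), which is harmless.
\<close>

lemma not_Ex_C_of_segments:
  fixes seg :: "nat \<Rightarrow> nat option list option" and x :: "nat \<Rightarrow> nat"
  assumes seg_0: "seg 0 = Some [Some (x 0)]"
    and seg_Suc: "\<And>k \<tau>. seg (Suc k) = Some \<tau> \<Longrightarrow> \<exists>\<sigma> n v. seg k = Some \<sigma> \<and>
      \<tau> = \<sigma> @ replicate n None @ [Some (x (Suc k))] \<and>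
      h (code_seq (\<sigma> @ replicate n None)) = Some v \<and> \<phi> (v - 1) (x (Suc k)) = Some 0"
    and seg_None: "\<And>k \<sigma> n v. seg k = Some \<sigma> \<Longrightarrow> seg (Suc k) = None \<Longrightarrow>
      h (code_seq (\<sigma> @ replicate n None)) = Some v \<Longrightarrow> \<phi> (v - 1) (x (Suc k)) \<noteq> Some 0"
    and inj: "inj x"
  shows "\<exists>T. is_text_for T {x k |k. seg k \<noteq> None} \<and> \<not> Ex_C \<phi> (G h T) T"
proof -
  have prefix: "\<exists>\<sigma> \<rho>. seg j = Some \<sigma> \<and> \<tau> = \<sigma> @ \<rho>" if "j \<le> k" "seg k = Some \<tau>" for j k \<tau>
    using that
  proof (induction k arbitrary: \<tau>)
    case (Suc k)
    then show ?case
      using seg_Suc[OF Suc.prems(2)] by (cases "j = Suc k") fastforce+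
  qed simp
  \<comment> \<open>Each stage adds a datum, so the segment with number \<open>n\<^sub>0\<close>
    will reach past a point of convergence \<open>n\<^sub>0\<close>.\<close>
  have long: "k < length \<sigma>" if "seg k = Some \<sigma>" for k \<sigma>
    using that
  proof (induction k arbitrary: \<sigma>)
    case (Suc k)
    then show ?case
      using seg_Suc[OF Suc.prems] by fastforce
  qed (simp add: seg_0)
  have set: "Some ` x ` {..k} \<subseteq> set \<sigma> \<and> set \<sigma> \<subseteq> insert None (Some ` x ` {..k})"
    if "seg k = Some \<sigma>" for k \<sigma>
    using that
  proof (induction k arbitrary: \<sigma>)
    case (Suc k)
    obtain \<sigma>' n where "seg k = Some \<sigma>'" "\<sigma> = \<sigma>' @ replicate n None @ [Some (x (Suc k))]"
      using seg_Suc[OF Suc.prems] by blast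
    then show ?case
      using Suc.IH[of \<sigma>'] by (auto simp: atMost_Suc split: if_splits)
  qed (auto simp: seg_0)
  have agree: "\<sigma> ! i = \<tau> ! i"
    if "seg j = Some \<sigma>" "seg k = Some \<tau>" "i < length \<sigma>" "i < length \<tau>" for i j k \<sigma> \<tau>
    using prefix[of j k \<tau>] prefix[of k j \<sigma>] that
    by (cases "j \<le> k") (auto simp: nth_append)
  \<comment> \<open>The common extension of all segments, padded with pauses if it is finite. By
    \<open>agree\<close>, the choice operator has only one candidate.\<close>
  define T :: lang_text where
    "T i = (if \<exists>k \<sigma>. seg k = Some \<sigma> \<and> i < length \<sigma>
      then (SOME d. \<exists>k \<sigma>. seg k = Some \<sigma> \<and> i < length \<sigma> \<and> d = \<sigma> ! i) else None)" for i
  have T_nth: "T i = \<sigma> ! i" if "seg k = Some \<sigma>" "i < length \<sigma>" for i k \<sigma>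
  proof -
    have "(SOME d. \<exists>k \<sigma>. seg k = Some \<sigma> \<and> i < length \<sigma> \<and> d = \<sigma> ! i) = \<sigma> ! i"
      by (rule some_equality) (use that agree in blast)+
    then show ?thesis
      using that by (auto simp: T_def)
  qed
  have T_init: "initial_segment T (length \<sigma>) = \<sigma>" if "seg k = Some \<sigma>" for k \<sigma>
    using T_nth[OF that] by (auto simp: initial_segment_def intro!: nth_equalityI)
  have content: "content T = {x k |k. seg k \<noteq> None}"
  proof (intro set_eqI iffI)
    fix y
    assume "y \<in> content T"
    then obtain i where i: "T i = Some y"
      by (auto simp: content_def)
    then obtain k \<sigma> where k: "seg k = Some \<sigma>" "i < length \<sigma>"
      by (auto simp: T_def split: if_splits)
    then have "Some y \<in> set \<sigma>"
      using T_nth[OF k] i by (metis nth_mem)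
    then obtain j where "j \<le> k" "y = x j"
      using set[OF k(1)] by auto
    then show "y \<in> {x k |k. seg k \<noteq> None}"
      using prefix[OF _ k(1)] by fastforce
  next
    fix y
    assume "y \<in> {x k |k. seg k \<noteq> None}"
    then obtain k \<sigma> where k: "y = x k" "seg k = Some \<sigma>"
      by auto
    then have "Some y \<in> set \<sigma>"
      using set[OF k(2)] by auto
    then obtain i where "i < length \<sigma>" "\<sigma> ! i = Some y"
      by (auto simp: in_set_conv_nth)
    then show "y \<in> content T"
      using T_nth[OF k(2), of i] by (auto simp: content_def intro!: range_eqI[of _ _ i])
  qed
  have "\<not> Ex_C \<phi> (G h T) T"
  proof
    assume "Ex_C \<phi> (G h T) T"
    then obtain n\<^sub>0 i where conv: "\<And>n. n\<^sub>0 \<le> n \<Longrightarrow> G h T n = Some (Index i)"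
      and i: "C_index \<phi> i" "C_set \<phi> i = content T"
      unfolding Ex_C_def by metis
    \<comment> \<open>The output code 0 is reserved for \<open>Query\<close>, hence the
      successor.\<close>
    have conj: "h (code_seq (initial_segment T n)) = Some (Suc i)" if "n\<^sub>0 \<le> n" for n
    proof -
      from conv[OF that] obtain c
        where "h (code_seq (initial_segment T n)) = Some c" "decode_hyp c = Index i"
        by (auto simp: G_def hyp_output_def)
      then show ?thesis
        by (cases c) auto
    qed
    show False
    proof (cases "\<forall>k. seg k \<noteq> None")
      \<comment> \<open>The segment with number \<open>n\<^sub>0\<close> is longer than
        \<open>n\<^sub>0\<close>, so the conjecture found by the next search is already the final
        \<open>i\<close>. It rejects \<open>x (Suc n\<^sub>0)\<close>, which the next segment
        nevertheless puts into the content.\<close>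
      case True
      then obtain \<tau> where \<tau>: "seg (Suc n\<^sub>0) = Some \<tau>"
        by blast
      obtain \<sigma> n v where \<sigma>: "seg n\<^sub>0 = Some \<sigma>"
        "\<tau> = \<sigma> @ replicate n None @ [Some (x (Suc n\<^sub>0))]"
        and v: "h (code_seq (\<sigma> @ replicate n None)) = Some v" "\<phi> (v - 1) (x (Suc n\<^sub>0)) = Some 0"
        using seg_Suc[OF \<tau>] by blast
      have "initial_segment T (length (\<sigma> @ replicate n None)) =
          take (length (\<sigma> @ replicate n None)) (initial_segment T (length \<tau>))"
        using \<sigma>(2) by (simp add: initial_segment_def take_map)
      then have "initial_segment T (length (\<sigma> @ replicate n None)) = \<sigma> @ replicate n None"
        unfolding T_init[OF \<tau>] by (simp add: \<sigma>(2))
      then have "v = Suc i"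
        using conj[of "length (\<sigma> @ replicate n None)"] long[OF \<sigma>(1)] v(1) by simp
      moreover have "x (Suc n\<^sub>0) \<in> C_set \<phi> i"
        using True unfolding i(2) content by blast
      ultimately show False
        using v(2) by (simp add: C_set_def)
    next
      \<comment> \<open>After the last segment only pauses follow, so the final conjecture is among
        those examined by the failed search. It does not reject \<open>x (Suc k)\<close>, hence,
        being a \<open>C_index\<close>, it accepts it.\<close>
      case False
      define m where "m = (LEAST k. seg k = None)"
      from False obtain l where "seg l = None"
        by blast
      then have m: "seg m = None"
        unfolding m_def by (rule LeastI)
      then obtain k where k: "m = Suc k"
        using seg_0 by (cases m) auto
      have "seg k \<noteq> None"
        using not_less_Least[of k "\<lambda>k. seg k = None"] k unfolding m_def[symmetric] by simp
      then obtain \<sigma> where \<sigma>: "seg k = Some \<sigma>"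
        by blast
      have last: "j \<le> k" if "seg j \<noteq> None" for j
        using prefix[of m j] that m k by (cases "j \<le> k") auto
      have pause: "T (length \<sigma> + j) = None" for j
      proof -
        have "length \<tau> \<le> length \<sigma>" if "seg l = Some \<tau>" for l \<tau>
          using prefix[of l k \<sigma>] last[of l] that \<sigma> by auto
        then have "\<not> (\<exists>l \<tau>. seg l = Some \<tau> \<and> length \<sigma> + j < length \<tau>)"
          by fastforce
        then show ?thesis
          unfolding T_def by (rule if_not_P)
      qed
      have "initial_segment T (length \<sigma> + n) = \<sigma> @ replicate n None" for n
      proof (induction n)
        case 0
        then show ?case
          using T_init[OF \<sigma>] by simp
      next
        case (Suc n)
        then show ?case
          using pause[of n] by (simp add: initial_segment_def replicate_append_same)
      qed
      then have "h (code_seq (\<sigma> @ replicate n\<^sub>0 None)) = Some (Suc i)"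
        using conj[of "length \<sigma> + n\<^sub>0"] by simp
      then have "\<phi> i (x (Suc k)) \<noteq> Some 0"
        using seg_None[OF \<sigma>] m k by fastforce
      then have "x (Suc k) \<in> content T"
        using i unfolding C_index_def C_set_def by auto
      \<comment> \<open>By injectivity, \<open>x (Suc k)\<close> could only have entered at stage
        \<open>Suc k\<close>, which is undefined.\<close>
      then show False
        using m k inj by (auto simp: content inj_eq)
    qed
  qed
  with content show ?thesis
    by (auto simp: is_text_for_def)
qed

text \<open>Segments are computed as codes of the reversed lists, so that data are appended by consing.\<close>

definition decode_data :: "nat \<Rightarrow> nat option list" where
  "decode_data c = map (\<lambda>d. case d of 0 \<Rightarrow> None | Suc y \<Rightarrow> Some y) (rev (list_decode c))"

text \<open>The learner expects data in order of presentation, but segments are stored newest first;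
  pauses are therefore consed on before the reversal.\<close>

lemma code_seq_pad:
  "code_seq (decode_data c @ replicate n None) = rev_code (pad_code n c)"
proof -
  have "code_datum (case d of 0 \<Rightarrow> None | Suc y \<Rightarrow> Some y) = d" for d
    by (cases d) auto
  then have "code_seq (decode_data c @ replicate n None) =
      list_encode (rev (replicate n 0 @ list_decode c))"
    by (simp add: code_seq_def decode_data_def comp_def)
  also have "\<dots> = rev_code (pad_code n (list_encode (list_decode c)))"
    by (simp only: rev_code pad_code)
  finally show ?thesis
    by simp
qed

lemma decode_data_snoc:
  "decode_data (cons_code (Suc y) (pad_code n c)) = decode_data c @ replicate n None @ [Some y]"
proof -
  have "cons_code (Suc y) (pad_code n (list_encode (list_decode c))) =
      list_encode (Suc y # replicate n 0 @ list_decode c)"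
    by (simp only: cons_code pad_code)
  then show ?thesis
    by (simp add: decode_data_def)
qed

lemma prec_universal:
  assumes "partial_computable2 \<phi>" "trec k a" "trec k b"
  shows "prec k (\<lambda>xs. \<phi> (a xs) (b xs))"
  using assms(2,3) by (rule prec_app2[OF assms(1)[unfolded partial_computable2_iff]])

text \<open>One function of \<open>e\<close> and \<open>k\<close> computes all segments, so that
  later a single translation provides indices for all languages. A search that never ends makes its
  stage and all later ones undefined.\<close>

lemma computable_segments:
  assumes \<phi>: "partial_computable2 \<phi>"
  shows "\<exists>c. partial_computable2 c \<and> (\<forall>e.
    map_option decode_data (c e 0) = Some [Some (prod_encode (e, 0))] \<and>
    (\<forall>k. c e k = None \<longrightarrow> c e (Suc k) = None) \<and>
    (\<forall>k R. c e k = Some R \<longrightarrow>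
      (\<forall>S. c e (Suc k) = Some S \<longrightarrow> (\<exists>n v.
        decode_data S = decode_data R @ replicate n None @ [Some (prod_encode (e, Suc k))] \<and>
        \<phi> e (code_seq (decode_data R @ replicate n None)) = Some v \<and>
        \<phi> (v - 1) (prod_encode (e, Suc k)) = Some 0)) \<and>
      (c e (Suc k) = None \<longrightarrow> (\<forall>n v.
        \<phi> e (code_seq (decode_data R @ replicate n None)) = Some v \<longrightarrow>
        \<phi> (v - 1) (prod_encode (e, Suc k)) \<noteq> Some 0))))"
proof -
  \<comment> \<open>The argument order fits both uses: \<open>n\<close> comes first because
    \<open>prec_select\<close> searches for it, then the counter \<open>k\<close>, the previous
    segment \<open>R\<close> and the parameter \<open>e\<close>, as in a recursion.\<close>
  define test where "test xs = Option.bind (\<phi> (xs ! 3) (rev_code (pad_code (xs ! 0) (xs ! 2))))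
    (\<lambda>v. \<phi> (v - 1) (prod_encode (xs ! 3, Suc (xs ! 1))))" for xs
  have "prec (Suc 3) test"
    unfolding test_def
    by (intro prec_bind prec_universal[OF \<phi>] trec_rev_code trec_pad_code trec_prod_encode
        trec_Suc trec_pred trec_nth trec_nth_tl trec_hd) auto
  then obtain sel where sel: "prec 3 sel"
    and sel_Some: "\<And>n k R e. sel [k, R, e] = Some n \<Longrightarrow> test [n, k, R, e] = Some 0"
    and sel_None: "\<And>n k R e. sel [k, R, e] = None \<Longrightarrow> test [n, k, R, e] \<noteq> Some 0"
    using prec_select[of 3 test] by (auto simp: numeral_3_eq_3)
  \<comment> \<open>Code 0 is the empty list; \<open>pad_code 0 0\<close> gives the start the shape
    handled by \<open>decode_data_snoc\<close>.\<close>
  define c where "c e k = rec_nat (Some (cons_code (Suc (prod_encode (e, 0))) (pad_code 0 0)))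
    (\<lambda>m r. Option.bind r (\<lambda>R. Option.bind (sel [m, R, e])
      (\<lambda>n. Some (cons_code (Suc (prod_encode (e, Suc m))) (pad_code n R))))) k" for e k
  have "prec 2 (\<lambda>xs. c (xs ! 0) (xs ! 1))"
    unfolding c_def
  proof (intro prec_rec prec_bind trec_cons_code trec_pad_code trec_prod_encode trec_Suc
      trec_const trec_nth)
    have "prec (Suc (Suc 2)) (\<lambda>ys. sel (map (\<lambda>a. a ys) [\<lambda>ys. ys ! 0, \<lambda>ys. ys ! 1, \<lambda>ys. ys ! 2]))"
      using sel by (intro prec_comp_total) (auto simp: numeral_3_eq_3 intro!: trec_nth)
    then show "prec (Suc (Suc 2)) (\<lambda>ys. sel [ys ! 0, ys ! 1, drop 2 ys ! 0])"
      by (elim prec_cong) simp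
    \<comment> \<open>Here \<open>ys\<close> is \<open>[n, m, R, e, k]\<close>, so \<open>e\<close>
      sits at position 3.\<close>
    show "trec (Suc (Suc (Suc 2))) (\<lambda>ys. drop 2 (tl ys) ! 0)"
      by (rule prec_cong[OF trec_nth[of 3]]) (auto simp: nth_tl numeral_3_eq_3 numeral_2_eq_2)
  qed (auto intro!: trec_nth_tl trec_hd)
  then have "partial_computable2 c"
    by (simp add: partial_computable2_iff)
  moreover have "c e (Suc k) = Option.bind (c e k) (\<lambda>R. Option.bind (sel [k, R, e])
      (\<lambda>n. Some (cons_code (Suc (prod_encode (e, Suc k))) (pad_code n R))))" for e k
    by (simp add: c_def)
  moreover have "map_option decode_data (c e 0) = Some [Some (prod_encode (e, 0))]" for e
    unfolding c_def by (simp add: decode_data_snoc) (simp add: decode_data_def)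
  moreover have "test [n, k, R, e] = Option.bind
      (\<phi> e (code_seq (decode_data R @ replicate n None))) (\<lambda>v. \<phi> (v - 1) (prod_encode (e, Suc k)))"
    for n k R e
    by (simp add: test_def code_seq_pad)
  ultimately show ?thesis
    using sel_Some sel_None
    by (intro exI[of _ c]) (fastforce simp: bind_eq_Some_conv bind_eq_None_conv decode_data_snoc)
qed

section \<open>Transductive learners with a single conjecture\<close>

lemma Td_constant:
  assumes "h 0 = Some 0" "\<And>x. x \<in> content T \<Longrightarrow> h (Suc x) = Some (Suc i)"
  shows "Td h T n = Some (if \<exists>m<n. T m \<noteq> None then Index i else Query)"
proof (induction n)
  case (Suc n)
  show ?case
  proof (cases "T n")
    case None
    with Suc assms(1) show ?thesis
      by (auto simp: hyp_output_def less_Suc_eq)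
  next
    case (Some x)
    then have "x \<in> content T"
      by (auto simp: content_def intro!: range_eqI[of _ _ n])
    with Some assms(2) show ?thesis
      by (auto simp: hyp_output_def)
  qed
qed simp

text \<open>A pause yields \<open>Query\<close> and keeps the conjecture, every other datum yields
  \<open>i\<close>. Since \<open>L\<close> is nonempty, such a datum occurs, and the hypothesis is
  constant after it.\<close>

lemma Td_constant_Ex_W:
  assumes "h 0 = Some 0" "\<And>x. x \<in> L \<Longrightarrow> h (Suc x) = Some (Suc i)" "W_set \<phi> i = L" "L \<noteq> {}"
  shows "Txt_learns Td (Ex_W \<phi>) h L"
  unfolding Txt_learns_def is_text_for_def
proof (intro allI impI)
  fix T
  assume T: "content T = L"
  then obtain x where "Some x \<in> range T"
    using assms(4) by (auto simp: content_def)
  then obtain m where m: "T m \<noteq> None"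
    by (metis option.distinct(1) rangeE)
  have "Td h T n = Some (Index i)" if "Suc m \<le> n" for n
  proof -
    have "\<exists>m<n. T m \<noteq> None"
      using m that by (intro exI[of _ m]) simp
    then show ?thesis
      using Td_constant[of h T i n] assms(1,2) T by simp
  qed
  then show "Ex_W \<phi> (Td h T) T"
    unfolding Ex_W_def using assms(3) T by (intro exI[of _ "Suc m"]) (auto simp del: Td.simps)
qed

theorem theorem1:
  fixes \<phi> :: "nat \<Rightarrow> nat \<Rightarrow> nat option"
  assumes "acceptable_numbering \<phi>"
  shows "Txt_REC Td (Ex_W \<phi>) - Txt_REC G (Ex_C \<phi>) \<noteq> {}"
proof -
  have \<phi>: "partial_computable2 \<phi>"
    and range: "range \<phi> = {f. partial_computable f}"
    and translate: "\<And>\<psi>. partial_computable2 \<psi> \<Longrightarrow>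
      \<exists>t. total_computable t \<and> (\<forall>e. \<phi> (t e) = \<psi> e)"
    using assms by (auto simp: acceptable_numbering_def)
  obtain c where c: "partial_computable2 c"
    and c_0: "\<And>e. map_option decode_data (c e 0) = Some [Some (prod_encode (e, 0))]"
    and c_None: "\<And>e k. c e k = None \<Longrightarrow> c e (Suc k) = None"
    and c_Suc: "\<And>e k R S. c e k = Some R \<Longrightarrow> c e (Suc k) = Some S \<Longrightarrow> \<exists>n v.
        decode_data S = decode_data R @ replicate n None @ [Some (prod_encode (e, Suc k))] \<and>
        \<phi> e (code_seq (decode_data R @ replicate n None)) = Some v \<and>
        \<phi> (v - 1) (prod_encode (e, Suc k)) = Some 0"
    and c_stop: "\<And>e k R n v. c e k = Some R \<Longrightarrow> c e (Suc k) = None \<Longrightarrow>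
        \<phi> e (code_seq (decode_data R @ replicate n None)) = Some v \<Longrightarrow>
        \<phi> (v - 1) (prod_encode (e, Suc k)) \<noteq> Some 0"
    using computable_segments[OF \<phi>] by metis
  define L where "L e = {prod_encode (e, k) |k. c e k \<noteq> None}" for e
  have L_ne: "L e \<noteq> {}" for e
    using c_0[of e] by (auto simp: L_def)
  \<comment> \<open>Which case holds need not be decided effectively: undefinedness persists, so
    each \<open>L e\<close> is a full column or finite.\<close>
  have L_REC: "L e \<in> REC" for e
  proof (cases "\<forall>k. c e k \<noteq> None")
    case True
    then have "L e = range (\<lambda>k. prod_encode (e, k))"
      by (auto simp: L_def)
    then show ?thesis
      by (simp add: column_in_REC)
  next
    case False
    then obtain m where m: "c e m = None"
      by blast
    have "c e k = None" if "m \<le> k" for k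
      using that m by (induction rule: dec_induct) (auto intro: c_None)
    then have "L e \<subseteq> (\<lambda>k. prod_encode (e, k)) ` {..<m}"
      by (force simp: L_def not_less[symmetric])
    then show ?thesis
      by (intro finite_in_REC) (rule finite_surj[of "{..<m}"], auto)
  qed
  \<comment> \<open>Designed to have domain \<open>L e\<close>: the guard diverges off column
    \<open>e\<close>, and on it \<open>c\<close> halts exactly at the stages reached.\<close>
  define \<psi> where "\<psi> e x = Option.bind (if fst (prod_decode x) = e then Some 0 else None)
    (\<lambda>_ :: nat. c e (snd (prod_decode x)))" for e x
  have "partial_computable2 \<psi>"
    unfolding partial_computable2_iff \<psi>_def
  proof (rule prec_bind)
    \<comment> \<open>The guard has to diverge, which a conditional between total functions cannot
      do. Minimising a function constant in \<open>z\<close> returns 0 if the test is 0 and diverges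
      otherwise.\<close>
    let ?test = "\<lambda>xs. if fst (prod_decode (xs ! 1)) = xs ! 0 then 0 else 1 :: nat"
    have "trec (Suc 2) (\<lambda>ys. ?test (tl ys))"
      by (intro trec_if_eq trec_fst trec_nth_tl trec_const) auto
    then have "prec 2 (\<lambda>xs. if \<exists>z :: nat. ?test xs = 0
        then Some (LEAST z :: nat. ?test xs = 0) else None)"
      by (rule prec_least)
    then show "prec 2 (\<lambda>xs. if fst (prod_decode (xs ! 1)) = xs ! 0 then Some 0 else None)"
      by (elim prec_cong) auto
    show "prec (Suc 2) (\<lambda>ys. c (tl ys ! 0) (snd (prod_decode (tl ys ! 1))))"
      by (intro prec_universal[OF c] trec_snd trec_nth_tl) auto
  qed
  \<comment> \<open>Acceptability makes an index of \<open>\<psi> e\<close> computable from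
    \<open>e\<close>, as the learner requires.\<close>
  then obtain t where t: "total_computable t" "\<And>e. \<phi> (t e) = \<psi> e"
    using translate by blast
  have W: "W_set \<phi> (t e) = L e" for e
  proof -
    have "\<psi> e x \<noteq> None \<longleftrightarrow> x \<in> L e" for x
      by (cases "prod_decode x") (auto simp: \<psi>_def L_def dest: arg_cong[of _ _ prod_encode])
    then show ?thesis
      by (auto simp: W_set_def t(2) dom_def)
  qed
  \<comment> \<open>A datum is coded by 0 for a pause and by \<open>Suc x\<close> for
    \<open>x\<close>, and outputs are shifted likewise. Every element of \<open>L e\<close> reveals
    \<open>e\<close> as its first component.\<close>
  define h where "h d = Some (if d = 0 then 0 else Suc (t (fst (prod_decode (d - 1)))))" for d
  have "trec 1 (\<lambda>xs. t (fst (prod_decode (xs ! 0 - 1))))"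
    by (rule prec_app1[OF t(1)[unfolded total_computable_iff]])
      (intro trec_fst trec_pred trec_nth zero_less_one)
  then have "partial_computable h"
    unfolding partial_computable_iff h_def
    by (intro trec_if_zero trec_const trec_nth trec_Suc zero_less_one)
  moreover have "Txt_learns Td (Ex_W \<phi>) h (L e)" for e
    by (rule Td_constant_Ex_W[of h _ "t e"]) (use W L_ne in \<open>auto simp: h_def L_def\<close>)
  ultimately have "range L \<in> Txt_REC Td (Ex_W \<phi>)"
    using L_REC by (auto simp: Txt_REC_def)
  moreover have "range L \<notin> Txt_REC G (Ex_C \<phi>)"
  proof
    assume "range L \<in> Txt_REC G (Ex_C \<phi>)"
    then obtain g where "partial_computable g" and g: "\<And>e. Txt_learns G (Ex_C \<phi>) g (L e)"
      by (auto simp: Txt_REC_def)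
    \<comment> \<open>The alleged learner occurs in the numbering, and the language built against
      its own index defeats it.\<close>
    then obtain e where e: "\<phi> e = g"
      using range by (metis (mono_tags, lifting) mem_Collect_eq rangeE)
    define seg where "seg k = map_option decode_data (c e k)" for k
    have "\<exists>T. is_text_for T {prod_encode (e, k) |k. seg k \<noteq> None} \<and> \<not> Ex_C \<phi> (G g T) T"
    proof (rule not_Ex_C_of_segments)
      show "seg 0 = Some [Some (prod_encode (e, 0))]"
        by (simp add: seg_def c_0)
      show "\<exists>\<sigma> n v. seg k = Some \<sigma> \<and>
          \<tau> = \<sigma> @ replicate n None @ [Some (prod_encode (e, Suc k))] \<and>
          g (code_seq (\<sigma> @ replicate n None)) = Some v \<and>
          \<phi> (v - 1) (prod_encode (e, Suc k)) = Some 0" if "seg (Suc k) = Some \<tau>" for k \<tau>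
      proof -
        from that obtain S where S: "c e (Suc k) = Some S" "\<tau> = decode_data S"
          by (auto simp: seg_def)
        then obtain R where "c e k = Some R"
          using c_None[of e k] by fastforce
        with c_Suc[OF this S(1)] show ?thesis
          by (auto simp: seg_def S(2) e)
      qed
      show "\<phi> (v - 1) (prod_encode (e, Suc k)) \<noteq> Some 0"
        if "seg k = Some \<sigma>" "seg (Suc k) = None" "g (code_seq (\<sigma> @ replicate n None)) = Some v"
        for k \<sigma> n v
        using that c_stop[of e k _ n v] by (auto simp: seg_def e)
      show "inj (\<lambda>k. prod_encode (e, k))"
        by (auto simp: inj_def)
    qed
    then show False
      using g[of e] by (auto simp: seg_def L_def Txt_learns_def)
  qed
  ultimately show ?thesis
    by blast
qed

end
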